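(* Let $(X,d)$ be a Hadamard space and let $m$ be a positive integer. If $S_i : X \to X$ is a strongly quasi-nonexpansive mapping for all $i \in \{1,\dots,m\}$ and $\bigcap_{i=1}^m Fix(S_i) \neq \emptyset$, then $$Fix(S_m S_{m-1} \cdots S_1) = \bigcap_{i=1}^m Fix(S_i).$$
   Context: A Hadamard space is a complete $\mathrm{CAT}(0)$ space. Products of mappings denote composition: $S_m S_{m-1}\cdots S_1 = S_m\circ S_{m-1}\circ\cdots\circ S_1$. For $S : X \to X$, $Fix(S) = \{x \in X : S(x) = x\}$. $S$ is quasi-nonexpansive if $Fix(S) \neq \emptyset$ and $d(S(x),q) \le d(x,q)$ for all $x \in X$ and $q \in Fix(S)$. $S$ is strongly quasi-nonexpansive if $S$ is quasi-nonexpansive and $\lim_{n\to\infty} d(x_n, S(x_n)) = 0$ whenever $\{x_n\}$ is a bounded sequence in $X$ such that $\lim_{n\to\infty}[d(x_n,q) - d(S(x_n),q)] = 0$ for some $q \in Fix(S)$. *)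

theory Defs
  imports "HOL-Analysis.Analysis"
begin

text \<open>
  A geodesic is parametrised by arc length on \<open>[0, dist x y]\<close>; values of \<open>c\<close> outside
  this interval are irrelevant.
\<close>

definition (in metric_space) geodesic_path :: "(real \<Rightarrow> 'a) \<Rightarrow> 'a \<Rightarrow> 'a \<Rightarrow> bool" where
  "geodesic_path c x y \<longleftrightarrow> c 0 = x \<and> c (dist x y) = y \<and>
     (\<forall>s\<in>{0..dist x y}. \<forall>t\<in>{0..dist x y}. dist (c s) (c t) = \<bar>s - t\<bar>)"

definition (in metric_space) geodesic_segment :: "'a set \<Rightarrow> 'a \<Rightarrow> 'a \<Rightarrow> bool" where
  "geodesic_segment G x y \<longleftrightarrow> (\<exists>c. geodesic_path c x y \<and> G = c ` {0..dist x y})"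

definition (in metric_space) comparison_triangle ::
    "'a \<Rightarrow> 'a \<Rightarrow> 'a \<Rightarrow> real^2 \<Rightarrow> real^2 \<Rightarrow> real^2 \<Rightarrow> bool" where
  "comparison_triangle p q r p' q' r' \<longleftrightarrow>
     dist p' q' = dist p q \<and> dist q' r' = dist q r \<and> dist r' p' = dist r p"

text \<open>\<open>u'\<close> is the point of the Euclidean side \<open>[x', y']\<close> corresponding to \<open>u\<close> on the side \<open>G\<close>
  that starts at \<open>x\<close>.\<close>

definition (in metric_space) comparison_point ::
    "'a set \<Rightarrow> 'a \<Rightarrow> real^2 \<Rightarrow> real^2 \<Rightarrow> 'a \<Rightarrow> real^2 \<Rightarrow> bool" where
  "comparison_point G x x' y' u u' \<longleftrightarrow>
     u \<in> G \<and> u' \<in> closed_segment x' y' \<and> dist x' u' = dist x u"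

text \<open>
  Comparison triangles exist by the triangle inequality and are unique up to isometry of the
  plane, so quantifying universally over them amounts to choosing one. A point of the triangle
  may lie on several sides, and then has a comparison point for each of them.
\<close>

class cat0_space = metric_space +
  assumes geodesic_exists: "\<exists>c. geodesic_path c x y"
    and cat0_inequality:
      "\<lbrakk>geodesic_segment G1 p q; geodesic_segment G2 q r; geodesic_segment G3 r p;
        comparison_triangle p q r p' q' r';
        comparison_point G1 p p' q' u u' \<or> comparison_point G2 q q' r' u u' \<or>
          comparison_point G3 r r' p' u u';
        comparison_point G1 p p' q' v v' \<or> comparison_point G2 q q' r' v v' \<or>
          comparison_point G3 r r' p' v v'\<rbrakk>
       \<Longrightarrow> dist u v \<le> dist u' v'"

class hadamard_space = cat0_space + complete_space

definition Fix :: "('a \<Rightarrow> 'a) \<Rightarrow> 'a set" where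
  "Fix S = {x. S x = x}"

definition quasi_nonexpansive :: "('a::metric_space \<Rightarrow> 'a) \<Rightarrow> bool" where
  "quasi_nonexpansive S \<longleftrightarrow>
     Fix S \<noteq> {} \<and> (\<forall>x. \<forall>q\<in>Fix S. dist (S x) q \<le> dist x q)"

definition strongly_quasi_nonexpansive :: "('a::metric_space \<Rightarrow> 'a) \<Rightarrow> bool" where
  "strongly_quasi_nonexpansive S \<longleftrightarrow> quasi_nonexpansive S \<and>
     (\<forall>x :: nat \<Rightarrow> 'a.
        bounded (range x) \<and>
        (\<exists>q\<in>Fix S. (\<lambda>n. dist (x n) q - dist (S (x n)) q) \<longlonglongrightarrow> 0) \<longrightarrow>
        (\<lambda>n. dist (x n) (S (x n))) \<longlonglongrightarrow> 0)"

text \<open>The composition \<open>S m \<circ> \<dots> \<circ> S 1\<close>, with \<open>S 1\<close> applied first.\<close>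

primrec compose_upto :: "(nat \<Rightarrow> 'a \<Rightarrow> 'a) \<Rightarrow> nat \<Rightarrow> 'a \<Rightarrow> 'a" where
  "compose_upto S 0 = id"
| "compose_upto S (Suc n) = S (Suc n) \<circ> compose_upto S n"

end

theory Submission
  imports Defs
begin

text \<open>
  Fix a common fixed point \<open>p\<close>. Every factor weakly decreases the distance to \<open>p\<close>, so a fixed
  point \<open>x\<close> of the composition, whose distance to \<open>p\<close> is the same before and after all factors
  have been applied, cannot lose distance at any single factor. Strong quasi-nonexpansiveness,
  tested on a constant sequence, says that a point whose distance to a fixed point is not
  strictly decreased is itself fixed (\<open>strongly_quasi_nonexpansive_fixed_if_dist_eq\<close>). Hence
  \<open>S 1\<close> fixes \<open>x\<close>, so \<open>S 2\<close> is again applied to \<open>x\<close> and fixes it, and so on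
  (\<open>common_fixed_if_compose_upto_dist_eq\<close>).
\<close>

text \<open>
  The asymptotic condition, applied to the constant sequence \<open>x, x, \<dots>\<close>, forces the constant
  \<open>dist x (S x)\<close> to tend to \<open>0\<close>.
\<close>

lemma strongly_quasi_nonexpansive_fixed_if_dist_eq:
  fixes S :: "'a::metric_space \<Rightarrow> 'a"
  assumes S: "strongly_quasi_nonexpansive S" and q: "q \<in> Fix S"
    and eq: "dist (S x) q = dist x q"
  shows "S x = x"
proof -
  have "bounded (range (\<lambda>_::nat. x))"
    by simp
  moreover have "(\<lambda>n::nat. dist x q - dist (S x) q) \<longlonglongrightarrow> 0"
    using eq by simp
  ultimately have "(\<lambda>n::nat. dist x (S x)) \<longlonglongrightarrow> 0"
    using S q unfolding strongly_quasi_nonexpansive_def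
    by (auto dest!: conjunct2 spec[where x = "\<lambda>_::nat. x"])
  then have "dist x (S x) = 0"
    by (simp add: LIMSEQ_const_iff)
  then show ?thesis
    by simp
qed

lemma strongly_quasi_nonexpansive_dist_le:
  assumes "strongly_quasi_nonexpansive S" "q \<in> Fix S"
  shows "dist (S x) q \<le> dist x q"
  using assms by (simp add: strongly_quasi_nonexpansive_def quasi_nonexpansive_def)

lemma compose_upto_common_fixed:
  assumes "\<And>i. i \<in> {1..n} \<Longrightarrow> x \<in> Fix (S i)"
  shows "compose_upto S n x = x"
  using assms by (induction n) (auto simp: Fix_def)

lemma compose_upto_dist_le:
  fixes S :: "nat \<Rightarrow> 'a::metric_space \<Rightarrow> 'a"
  assumes "\<And>i. i \<in> {1..n} \<Longrightarrow> strongly_quasi_nonexpansive (S i)"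
    and "\<And>i. i \<in> {1..n} \<Longrightarrow> p \<in> Fix (S i)"
  shows "dist (compose_upto S n x) p \<le> dist x p"
  using assms
proof (induction n)
  case (Suc n)
  have "dist (compose_upto S (Suc n) x) p \<le> dist (compose_upto S n x) p"
    using Suc.prems by (simp add: strongly_quasi_nonexpansive_dist_le)
  also have "\<dots> \<le> dist x p"
    using Suc by simp
  finally show ?case .
qed simp

text \<open>
  The equality case of the preceding bound. Assuming equality of distances instead of
  \<open>compose_upto S n x = x\<close> is what makes the induction work: equality passes to the shorter
  composition, because no later factor can restore distance that was lost, whereas being a
  fixed point does not obviously do so.
\<close>

lemma common_fixed_if_compose_upto_dist_eq:
  fixes S :: "nat \<Rightarrow> 'a::metric_space \<Rightarrow> 'a"
  assumes "\<And>i. i \<in> {1..n} \<Longrightarrow> strongly_quasi_nonexpansive (S i)"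
    and "\<And>i. i \<in> {1..n} \<Longrightarrow> p \<in> Fix (S i)"
    and "dist (compose_upto S n x) p = dist x p"
  shows "\<forall>i\<in>{1..n}. x \<in> Fix (S i)"
  using assms
proof (induction n)
  case (Suc n)
  have sqn: "strongly_quasi_nonexpansive (S (Suc n))" and p: "p \<in> Fix (S (Suc n))"
    using Suc.prems by simp_all
  have "dist x p \<le> dist (compose_upto S n x) p"
    using strongly_quasi_nonexpansive_dist_le[OF sqn p, of "compose_upto S n x"] Suc.prems(3)
    by simp
  moreover have "dist (compose_upto S n x) p \<le> dist x p"
    using Suc.prems by (intro compose_upto_dist_le) auto
  ultimately have fixed: "\<forall>i\<in>{1..n}. x \<in> Fix (S i)"
    using Suc.prems by (intro Suc.IH) auto
  then have "compose_upto S n x = x"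
    by (intro compose_upto_common_fixed) auto
  then have "S (Suc n) x = x"
    using Suc.prems(3) by (intro strongly_quasi_nonexpansive_fixed_if_dist_eq[OF sqn p]) simp
  with fixed show ?case
    by (auto simp: Fix_def le_Suc_eq)
qed simp

theorem lemma3:
  fixes S :: "nat \<Rightarrow> 'a::hadamard_space \<Rightarrow> 'a" and m :: nat
  assumes "m \<ge> 1"
    and "\<And>i. i \<in> {1..m} \<Longrightarrow> strongly_quasi_nonexpansive (S i)"
    and "(\<Inter>i\<in>{1..m}. Fix (S i)) \<noteq> {}"
  shows "Fix (compose_upto S m) = (\<Inter>i\<in>{1..m}. Fix (S i))"
proof
  obtain p where p: "\<And>i. i \<in> {1..m} \<Longrightarrow> p \<in> Fix (S i)"
    using assms(3) by blast
  show "Fix (compose_upto S m) \<subseteq> (\<Inter>i\<in>{1..m}. Fix (S i))"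
  proof
    fix x assume "x \<in> Fix (compose_upto S m)"
    then have "dist (compose_upto S m x) p = dist x p"
      by (simp add: Fix_def)
    with common_fixed_if_compose_upto_dist_eq[of m S p x] assms(2) p
    show "x \<in> (\<Inter>i\<in>{1..m}. Fix (S i))"
      by blast
  qed
  show "(\<Inter>i\<in>{1..m}. Fix (S i)) \<subseteq> Fix (compose_upto S m)"
  proof
    fix x assume "x \<in> (\<Inter>i\<in>{1..m}. Fix (S i))"
    then have "compose_upto S m x = x"
      by (intro compose_upto_common_fixed) blast
    then show "x \<in> Fix (compose_upto S m)"
      by (simp add: Fix_def)
  qed
qed

end
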